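(* Let $q$ be a prime power and $n$ a positive integer. Multispace codes over $\mathbb{F}_q^n$ of arbitrarily large cardinality and minimum distance exist; that is, for all positive integers $N$ and $D$ there exists a finite code $\mathcal{C}\subseteq\mathcal{M}_q(n)$ with $|\mathcal{C}|\geqslant N$ and $d(W_1,W_2)\geqslant D$ for all distinct $W_1,W_2\in\mathcal{C}$.
   Context: A multiset $M$ over a universe $U$ is given by a multiplicity function $\mu_M\colon U\to\{0,1,2,\ldots\}$; its size is $|M|=\sum_{a\in U}\mu_M(a)$, and $M_1\subseteq M_2$ means $\mu_{M_1}\leqslant\mu_{M_2}$ pointwise. For a finite multiset $B=\{\!\{b_1,\ldots,b_m\}\!\}$ over $\mathbb{F}_q^n$ (the $b_i$ are not necessarily distinct), the multispan $\operatorname{mspan}_q(B)$ is the multiset over $\mathbb{F}_q^n$ in which the multiplicity of $v$ is the number of $m$-tuples $(\alpha_1,\ldots,\alpha_m)\in\mathbb{F}_q^m$ with $\sum_{i=1}^m\alpha_i b_i=v$; if $B$ is empty, $\operatorname{mspan}_q(B)=\{0\}$ (with $0$ of multiplicity $1$). A multiset $W$ over $\mathbb{F}_q^n$ is a multispace over $\mathbb{F}_q^n$ if $W=\operatorname{mspan}_q(B)$ for some multiset $B$; then $\operatorname{rank}(W)=|B|=\log_q|W|$. $\mathcal{M}_q(n)$ is the collection of all multispaces over $\mathbb{F}_q^n$, and a multispace code is a subset of $\mathcal{M}_q(n)$. The poset $(\mathcal{M}_q(n),\subseteq)$ is a lattice with meet $\land$ and join $\lor$; the meet $W_1\land W_2$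 is the multiset intersection (with multiplicity function $\min\{\mu_{W_1},\mu_{W_2}\}$). The metric $d$ on $\mathcal{M}_q(n)$ is $$d(W_1,W_2)=\operatorname{rank}(W_1\lor W_2)-\operatorname{rank}(W_1\land W_2)=\operatorname{rank}(W_1)+\operatorname{rank}(W_2)-2\operatorname{rank}(W_1\land W_2).$$ The minimum distance of a code is the minimum of $d(W_1,W_2)$ over distinct codewords $W_1,W_2$. *)

theory Defs
  imports "HOL-Analysis.Cartesian_Space" "HOL-Library.Multiset"
begin

text \<open>
  The finite field is a type \<open>'a :: {field,finite}\<close> with \<open>q = CARD('a)\<close>, and its n-dimensional
  coordinate space is \<open>'a ^ 'n\<close> with \<open>n = CARD('n)\<close>. This universe is finite, so the finite
  multisets of type \<open>('a ^ 'n) multiset\<close> are all multisets over it.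
\<close>

definition mspan_list :: "('a::{field,finite} ^ 'n) list \<Rightarrow> ('a ^ 'n) multiset" where
  "mspan_list bs =
     image_mset (\<lambda>as. \<Sum>i<length bs. as ! i *s bs ! i) (mset_set {as. length as = length bs})"

text \<open>
  The choice of an enumeration is immaterial, see \<open>count_mspan\<close> and \<open>mspan_mset\<close> below.
\<close>
definition mspan :: "('a::{field,finite} ^ 'n) multiset \<Rightarrow> ('a ^ 'n) multiset" where
  "mspan B = mspan_list (SOME bs. mset bs = B)"

definition multispaces :: "('a::{field,finite} ^ 'n) multiset set" where
  "multispaces = range mspan"

definition mrank :: "('a::{field,finite} ^ 'n) multiset \<Rightarrow> nat" where
  "mrank W = (THE m. \<exists>B. W = mspan B \<and> size B = m)"

definition is_mjoin ::
    "('a::{field,finite} ^ 'n) multiset \<Rightarrow> ('a ^ 'n) multiset \<Rightarrow> ('a ^ 'n) multiset \<Rightarrow> bool" where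
  "is_mjoin W1 W2 J \<longleftrightarrow> J \<in> multispaces \<and> W1 \<subseteq># J \<and> W2 \<subseteq># J \<and>
     (\<forall>W\<in>multispaces. W1 \<subseteq># W \<longrightarrow> W2 \<subseteq># W \<longrightarrow> J \<subseteq># W)"

definition mjoin ::
    "('a::{field,finite} ^ 'n) multiset \<Rightarrow> ('a ^ 'n) multiset \<Rightarrow> ('a ^ 'n) multiset" where
  "mjoin W1 W2 = (THE J. is_mjoin W1 W2 J)"

text \<open>The meet is the multiset intersection; it is again a multispace by \<open>inter_multispaces\<close>.\<close>
definition mdist :: "('a::{field,finite} ^ 'n) multiset \<Rightarrow> ('a ^ 'n) multiset \<Rightarrow> int" where
  "mdist W1 W2 = int (mrank (mjoin W1 W2)) - int (mrank (W1 \<inter># W2))"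


lemma finite_lists_of_length: "finite {as :: 'a::finite list. length as = m}"
  using finite_lists_length_eq[of "UNIV :: 'a set" m] by simp

lemma count_mspan_list:
  "count (mspan_list bs) v =
     card {as. length as = length bs \<and> (\<Sum>i<length bs. as ! i *s bs ! i) = v}"
proof -
  have "count (mspan_list bs) v =
      card ((\<lambda>as. \<Sum>i<length bs. as ! i *s bs ! i) -` {v} \<inter> {as. length as = length bs})"
    by (simp add: mspan_list_def count_image_mset finite_lists_of_length)
  also have "(\<lambda>as. \<Sum>i<length bs. as ! i *s bs ! i) -` {v} \<inter> {as. length as = length bs}
      = {as. length as = length bs \<and> (\<Sum>i<length bs. as ! i *s bs ! i) = v}"
    by auto
  finally show ?thesis .
qed

lemma count_mspan_list_Cons:
  fixes b :: "'a::{field,finite} ^ 'n"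
  shows "count (mspan_list (b # bs)) v = (\<Sum>a\<in>UNIV. count (mspan_list bs) (v - a *s b))"
proof -
  let ?S = "\<lambda>a. {as. length as = length bs \<and> (\<Sum>i<length bs. as ! i *s bs ! i) = v - a *s b}"
  let ?T = "{as. length as = length (b # bs) \<and>
      (\<Sum>i<length (b # bs). as ! i *s (b # bs) ! i) = v}"
  have "?T = (\<Union>a\<in>UNIV. (#) a ` ?S a)"
  proof (rule set_eqI)
    fix as :: "'a list"
    show "as \<in> ?T \<longleftrightarrow> as \<in> (\<Union>a\<in>UNIV. (#) a ` ?S a)"
      by (cases as) (auto simp del: sum.lessThan_Suc
          simp add: sum.lessThan_Suc_shift algebra_simps image_iff)
  qed
  moreover have "card (\<Union>a\<in>UNIV. (#) a ` ?S a) = (\<Sum>a\<in>UNIV. card ((#) a ` ?S a))"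
    by (rule card_UN_disjoint)
       (auto intro: finite_subset[OF _ finite_lists_of_length[of "length bs"]])
  moreover have "card ((#) a ` ?S a) = card (?S a)" for a
    by (rule card_image) simp
  ultimately show ?thesis
    by (simp add: count_mspan_list)
qed

lemma dim_set_le_length: "vec.dim (set bs) \<le> length bs"
  for bs :: "('a::field ^ 'n) list"
  by (meson List.finite_set card_length le_trans vec.dim_le_card vec.span_superset)

lemma count_mspan_list_eq:
  fixes bs :: "('a::{field,finite} ^ 'n) list"
  shows "count (mspan_list bs) v =
    (if v \<in> vec.span (set bs) then CARD('a) ^ (length bs - vec.dim (set bs)) else 0)"
proof (induction bs arbitrary: v)
  case Nil
  have "{as :: 'a list. as = [] \<and> 0 = v} = (if v = 0 then {[]} else {})" by auto
  then show ?case by (simp add: count_mspan_list)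
next
  case (Cons b bs)
  let ?c = "CARD('a) ^ (length bs - vec.dim (set bs))"
  show ?case
  proof (cases "b \<in> vec.span (set bs)")
    case True
    have *: "v - a *s b \<in> vec.span (set bs) \<longleftrightarrow> v \<in> vec.span (set bs)" for a
      using True by (metis diff_add_cancel vec.span_add vec.span_diff vec.span_scale)
    have "vec.span (insert b (set bs)) = vec.span (set bs)"
      using True by (rule vec.span_redundant)
    moreover have "vec.dim (insert b (set bs)) = vec.dim (set bs)"
      using True by (simp add: vec.dim_insert)
    ultimately show ?thesis
      using dim_set_le_length[of bs]
      by (simp add: count_mspan_list_Cons Cons.IH * Suc_diff_le)
  next
    case False
    have dim: "vec.dim (insert b (set bs)) = Suc (vec.dim (set bs))"
      using False by (simp add: vec.dim_insert)
    have uniq: "a = a'"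
      if "v - a *s b \<in> vec.span (set bs)" "v - a' *s b \<in> vec.span (set bs)" for a a'
    proof (rule ccontr)
      assume "a \<noteq> a'"
      have "(a' - a) *s b \<in> vec.span (set bs)"
        using vec.span_diff[OF that] by (simp add: vec.scale_left_diff_distrib)
      from vec.span_scale[OF this, of "inverse (a' - a)"] \<open>a \<noteq> a'\<close> False
      show False by simp
    qed
    show ?thesis
    proof (cases "v \<in> vec.span (insert b (set bs))")
      case True
      then obtain k where k: "v - k *s b \<in> vec.span (set bs)"
        by (auto simp: vec.span_breakdown_eq)
      have "count (mspan_list (b # bs)) v = (\<Sum>a\<in>UNIV. if a = k then ?c else 0)"
        unfolding count_mspan_list_Cons Cons.IH
        by (rule sum.cong) (use k uniq in auto)
      then show ?thesis using True dim by simp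
    next
      case f: False
      then have "v - a *s b \<notin> vec.span (set bs)" for a
        by (auto simp: vec.span_breakdown_eq)
      then show ?thesis using f by (simp add: count_mspan_list_Cons Cons.IH)
    qed
  qed
qed

lemma mspan_mset: "mspan (mset bs) = mspan_list bs"
proof -
  have "mset (SOME bs'. mset bs' = mset bs) = mset bs"
    by (rule someI) (rule refl)
  then have "set (SOME bs'. mset bs' = mset bs) = set bs"
    and "length (SOME bs'. mset bs' = mset bs) = length bs"
    by (metis set_mset_mset, metis size_mset)
  then show ?thesis
    by (intro multiset_eqI) (simp add: mspan_def count_mspan_list_eq)
qed

lemma count_mspan:
  fixes bs :: "('a::{field,finite} ^ 'n) list"
  assumes "mset bs = B"
  shows "count (mspan B) v =
    card {as. length as = length bs \<and> (\<Sum>i<length bs. as ! i *s bs ! i) = v}"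
  using assms by (auto simp: mspan_mset count_mspan_list)

lemma mspan_empty: "mspan {#} = {#0#}"
  using mspan_mset[of "[]"] by (simp add: mspan_list_def)

lemma count_mspan_eq:
  fixes B :: "('a::{field,finite} ^ 'n) multiset"
  shows "count (mspan B) v =
    (if v \<in> vec.span (set_mset B) then CARD('a) ^ (size B - vec.dim (set_mset B)) else 0)"
proof -
  obtain bs where "mset bs = B" using ex_mset by blast
  then show ?thesis by (auto simp: mspan_mset count_mspan_list_eq)
qed

lemma size_mspan:
  fixes B :: "('a::{field,finite} ^ 'n) multiset"
  shows "size (mspan B) = CARD('a) ^ size B"
proof -
  obtain bs where "mset bs = B" using ex_mset by blast
  moreover have "card {as :: 'a list. length as = length bs} = CARD('a) ^ length bs"
    using card_lists_length_eq[of "UNIV :: 'a set" "length bs"] by simp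
  ultimately show ?thesis by (auto simp: mspan_mset mspan_list_def)
qed

lemma card_field_gt_1: "CARD('a::{field,finite}) > 1"
proof -
  have "card {0, 1 :: 'a} \<le> CARD('a)" by (intro card_mono) simp_all
  then show ?thesis by simp
qed

lemma mrank_mspan: "mrank (mspan B) = size B"
  for B :: "('a::{field,finite} ^ 'n) multiset"
proof -
  have "size B' = size B" if "mspan B = mspan B'" for B' :: "('a ^ 'n) multiset"
    using arg_cong[OF that, of size] card_field_gt_1[where 'a = 'a] by (simp add: size_mspan)
  then show ?thesis unfolding mrank_def by (intro the_equality) blast+
qed

lemma mrank_log:
  fixes W :: "('a::{field,finite} ^ 'n) multiset"
  assumes "W \<in> multispaces"
  shows "size W = CARD('a) ^ mrank W"
  using assms by (auto simp: multispaces_def size_mspan mrank_mspan)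

lemma dim_set_mset_le_size: "vec.dim (set_mset B) \<le> size B"
  for B :: "('a::field ^ 'n) multiset"
  by (metis dim_set_le_length ex_mset set_mset_mset size_mset)

text \<open>A multispace is a subspace taken with constant multiplicity a power of \<open>q\<close>.\<close>

lemma multispace_cases:
  fixes W :: "('a::{field,finite} ^ 'n) multiset"
  assumes "W \<in> multispaces"
  obtains V c where "vec.subspace V" "\<And>v. count W v = (if v \<in> V then CARD('a) ^ c else 0)"
    "mrank W = vec.dim V + c"
proof -
  obtain B where B: "W = mspan B" using assms by (auto simp: multispaces_def)
  show ?thesis
    by (rule that[of "vec.span (set_mset B)" "size B - vec.dim (set_mset B)"])
       (use B dim_set_mset_le_size[of B] in \<open>auto simp: count_mspan_eq mrank_mspan\<close>)
qed

lemma multispaceI: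
  fixes W :: "('a::{field,finite} ^ 'n) multiset"
  assumes V: "vec.subspace V"
    and W: "\<And>v. count W v = (if v \<in> V then CARD('a) ^ c else 0)"
  shows "W \<in> multispaces" "mrank W = vec.dim V + c"
proof -
  obtain b where b: "b \<subseteq> V" "vec.independent b" "V \<subseteq> vec.span b" "card b = vec.dim V"
    using vec.basis_exists by blast
  have fin: "finite b" using b(2) by (rule vec.finiteI_independent)
  have sp: "vec.span b = V" using b V by (intro vec.span_subspace)
  define B where "B = mset_set b + replicate_mset c 0"
  have set: "vec.span (set_mset B) = V"
    using fin sp by (auto simp: B_def)
  have dim: "vec.dim (set_mset B) = vec.dim V"
    by (metis set vec.dim_span)
  have size: "size B = vec.dim V + c" using b(4) by (simp add: B_def)
  have "W = mspan B"
    by (rule multiset_eqI) (simp add: W count_mspan_eq set dim size)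
  then show "W \<in> multispaces" "mrank W = vec.dim V + c"
    by (simp_all add: multispaces_def mrank_mspan size)
qed

lemma
  fixes W1 W2 :: "('a::{field,finite} ^ 'n) multiset"
  assumes "W1 \<in> multispaces" "W2 \<in> multispaces"
  shows inter_multispaces: "W1 \<inter># W2 \<in> multispaces"
    and is_mjoin_mjoin: "is_mjoin W1 W2 (mjoin W1 W2)"
    and mdist_eq: "mdist W1 W2 = int (mrank W1) + int (mrank W2) - 2 * int (mrank (W1 \<inter># W2))"
proof -
  obtain V1 c1 where V1: "vec.subspace V1"
    and W1: "\<And>v. count W1 v = (if v \<in> V1 then CARD('a) ^ c1 else 0)"
    and r1: "mrank W1 = vec.dim V1 + c1"
    using multispace_cases[OF assms(1)] by blast
  obtain V2 c2 where V2: "vec.subspace V2"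
    and W2: "\<And>v. count W2 v = (if v \<in> V2 then CARD('a) ^ c2 else 0)"
    and r2: "mrank W2 = vec.dim V2 + c2"
    using multispace_cases[OF assms(2)] by blast
  have q: "CARD('a) > 1" by (rule card_field_gt_1)
  have I: "vec.subspace (V1 \<inter> V2)" using V1 V2 by (rule vec.subspace_inter)
  have cI: "count (W1 \<inter># W2) v = (if v \<in> V1 \<inter> V2 then CARD('a) ^ min c1 c2 else 0)" for v
    using q by (auto simp: W1 W2 min_def)
  show inter: "W1 \<inter># W2 \<in> multispaces" by (rule multispaceI[OF I cI])
  have rI: "mrank (W1 \<inter># W2) = vec.dim (V1 \<inter> V2) + min c1 c2" by (rule multispaceI[OF I cI])
  define S where "S = {x + y | x y. x \<in> V1 \<and> y \<in> V2}"
  have S: "vec.subspace S" unfolding S_def by (rule vec.subspace_sums[OF V1 V2])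
  have S1: "V1 \<subseteq> S" unfolding S_def using vec.subspace_0[OF V2] by force
  have S2: "V2 \<subseteq> S" unfolding S_def using vec.subspace_0[OF V1] by force
  define J where "J = repeat_mset (CARD('a) ^ max c1 c2) (mset_set S)"
  have cJ: "count J v = (if v \<in> S then CARD('a) ^ max c1 c2 else 0)" for v
    by (simp add: J_def)
  have rJ: "mrank J = vec.dim S + max c1 c2" and mJ: "J \<in> multispaces"
    by (rule multispaceI[OF S cJ])+
  have J: "is_mjoin W1 W2 J"
    unfolding is_mjoin_def
  proof (intro conjI ballI impI mJ)
    show "W1 \<subseteq># J" "W2 \<subseteq># J"
      using S1 S2 q by (auto simp: subseteq_mset_def W1 W2 cJ intro!: power_increasing)
  next
    fix W :: "('a ^ 'n) multiset"
    assume W: "W \<in> multispaces" and le: "W1 \<subseteq># W" "W2 \<subseteq># W"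
    obtain V c where V: "vec.subspace V" and cW: "\<And>v. count W v = (if v \<in> V then CARD('a) ^ c else 0)"
      using multispace_cases[OF W] by blast
    have le1: "count W1 v \<le> count W v" and le2: "count W2 v \<le> count W v" for v
      using le by (auto simp: subseteq_mset_def)
    have "V1 \<subseteq> V" "V2 \<subseteq> V"
      using le1 le2 q by (force simp: W1 W2 cW split: if_splits)+
    then have "S \<subseteq> V" using V by (auto simp: S_def intro: vec.subspace_add)
    moreover have "c1 \<le> c" "c2 \<le> c"
      using le1[of 0] le2[of 0] q vec.subspace_0[OF V] vec.subspace_0[OF V1] vec.subspace_0[OF V2]
      by (auto simp: W1 W2 cW)
    ultimately show "J \<subseteq># W"
      using q by (auto simp: subseteq_mset_def cJ cW intro!: power_increasing)
  qed
  have jJ: "mjoin W1 W2 = J"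
    unfolding mjoin_def
  proof (rule the_equality)
    show "is_mjoin W1 W2 J" by (rule J)
  next
    fix J' assume "is_mjoin W1 W2 J'"
    with J show "J' = J" unfolding is_mjoin_def by (meson subset_mset.order_antisym)
  qed
  with J show "is_mjoin W1 W2 (mjoin W1 W2)" by simp
  have "vec.dim S + vec.dim (V1 \<inter> V2) = vec.dim V1 + vec.dim V2"
    unfolding S_def by (rule vec.dim_sums_Int[OF V1 V2])
  then show "mdist W1 W2 = int (mrank W1) + int (mrank W2) - 2 * int (mrank (W1 \<inter># W2))"
    by (simp add: mdist_def jJ rJ rI r1 r2 min_def max_def)
qed

end

(* A repeated zero vector spans {0} with multiplicity q ^ k, k being the number of repetitions.
   These multispaces form a chain graded by the rank k, on which the meet is the smaller one and
   the distance is the difference of the ranks; choosing ranks D apart gives the code. *)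
theory Submission
  imports Defs
begin

text \<open>Zero vectors add nothing to the dimension, so all \<open>k\<close> generators go into
  the exponent of the multiplicity formula \<open>count_mspan_eq\<close>.\<close>

lemma mspan_replicate_zero:
  "mspan (replicate_mset k (0 :: 'a::{field,finite} ^ 'n)) = replicate_mset (CARD('a) ^ k) 0"
proof (rule multiset_eqI)
  fix v :: "'a ^ 'n"
  \<comment> \<open>The support is empty for \<open>k = 0\<close> and {0} otherwise; passing to the
    span treats both cases alike.\<close>
  have "vec.span (set_mset (replicate_mset k (0 :: 'a ^ 'n))) = {0}"
    by simp
  moreover from this have "vec.dim (set_mset (replicate_mset k (0 :: 'a ^ 'n))) = 0"
    by (metis vec.dim_empty vec.dim_span vec.span_empty)
  ultimately show "count (mspan (replicate_mset k (0 :: 'a ^ 'n))) v =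
      count (replicate_mset (CARD('a) ^ k) 0) v"
    by (simp add: count_mspan_eq)
qed

lemma mdist_mspan_replicate_zero:
  "mdist (mspan (replicate_mset i (0 :: 'a::{field,finite} ^ 'n))) (mspan (replicate_mset j 0)) =
    \<bar>int i - int j\<bar>"
proof -
  have "mspan (replicate_mset i (0 :: 'a ^ 'n)) \<inter># mspan (replicate_mset j 0) =
      mspan (replicate_mset (min i j) 0)"
    \<comment> \<open>As q > 1, powers of q grow with the exponent, so the smaller of q ^ i and q ^
      j is q ^ min i j.\<close>
    using card_field_gt_1[where 'a = 'a]
    by (intro multiset_eqI) (auto simp: mspan_replicate_zero min_def)
  then show ?thesis
    by (simp add: mdist_eq multispaces_def mrank_mspan)
qed

theorem mainTheorem8:
  fixes N D :: nat
  assumes "N > 0" and "D > 0"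
  shows "\<exists>C :: ('a::{field,finite} ^ 'n) multiset set.
           finite C \<and> C \<subseteq> multispaces \<and> card C \<ge> N \<and>
           (\<forall>W1\<in>C. \<forall>W2\<in>C. W1 \<noteq> W2 \<longrightarrow> mdist W1 W2 \<ge> int D)"
proof -
  define W :: "nat \<Rightarrow> ('a ^ 'n) multiset" where "W i = mspan (replicate_mset (D * i) 0)" for i
  have dist: "mdist (W i) (W j) = int D * \<bar>int i - int j\<bar>" for i j
    by (simp add: W_def mdist_mspan_replicate_zero abs_mult flip: right_diff_distrib)
  \<comment> \<open>The rank \<open>D * i\<close> of \<open>W i\<close> determines \<open>i\<close>
    because \<open>D > 0\<close>; hence there are exactly \<open>N\<close> codewords.\<close>
  have "inj W"
  proof (rule injI)
    fix i j assume "W i = W j"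
    then have "mrank (W i) = mrank (W j)" by simp
    with \<open>D > 0\<close> show "i = j" by (simp add: W_def mrank_mspan)
  qed
  then have "card (W ` {..<N}) = N"
    by (simp add: card_image inj_on_subset)
  moreover have "mdist (W i) (W j) \<ge> int D" if "W i \<noteq> W j" for i j
  proof -
    from that have "i \<noteq> j" by auto
    then have "\<bar>int i - int j\<bar> \<ge> 1" by linarith
    then have "int D * 1 \<le> int D * \<bar>int i - int j\<bar>" by (intro mult_left_mono) simp_all
    then show ?thesis by (simp add: dist)
  qed
  moreover have "W ` {..<N} \<subseteq> multispaces"
    by (auto simp: W_def multispaces_def)
  ultimately show ?thesis
    by (intro exI[of _ "W ` {..<N}"]) auto
qed

end
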